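(* Let $k\ge1$ be an integer, let $m\ge k$ be an integer or $m=\infty$, let $t\ge0$ be an integer, and let $0<\theta,\gamma\le1$. Then $$\operatorname{NegOcc}(t\mid m,k,\gamma\theta)=\sum_{r=0}^{t}\operatorname{NegBin}(t-r\mid k+r,1-\theta)\cdot\operatorname{NegOcc}(r\mid m,k,\gamma).$$ In particular, for $\gamma=1$, $$\operatorname{NegOcc}(t\mid m,k,\theta)=\sum_{r=0}^{t}\operatorname{NegBin}(t-r\mid k+r,1-\theta)\cdot\operatorname{NegOcc}(r\mid m,k),$$ where $\operatorname{NegOcc}(r\mid m,k)=\operatorname{NegOcc}(r\mid m,k,1)$.
   Context: Noncentral Stirling numbers of the second kind: for an integer $n\ge0$ and real $\phi$, the numbers $S(n,k,\phi)$, $0\le k\le n$, are defined by the polynomial identity $(x+\phi)^n=\sum_{k=0}^n S(n,k,\phi)(x)_k$, where $(x)_k=\prod_{i=0}^{k-1}(x-i)$; $S(n,k,\phi)=0$ for $k>n$. Convention $0^0=1$. Negative binomial: $\operatorname{NegBin}(t\mid k,p)=\binom{k+t-1}{t}p^t(1-p)^k$ for $t=0,1,2,\dots$. Negative occupancy distribution: for integers $1\le k\le m<\infty$, $t\ge0$, and $0<\theta\le1$, $\operatorname{NegOcc}(t\mid m,k,\theta)=\frac{\theta^{k+t}}{m^{k+t}}(m)_k\,S\big(k+t-1,k-1,m\tfrac{1-\theta}{\theta}\big)$; for $m=\infty$, $\operatorname{NegOcc}(t\mid\infty,k,\theta)=\lim_{m\to\infty}\operatorname{NegOcc}(t\mid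 m,k,\theta)=\operatorname{NegBin}(t\mid k,1-\theta)$. *)

theory Defs
  imports Complex_Main "HOL-Library.Extended_Nat"
begin

definition falling_fact :: "real \<Rightarrow> nat \<Rightarrow> real" where
  "falling_fact x k = (\<Prod>i<k. x - real i)"

text \<open>The coefficient sequence selected by \<open>THE\<close> exists and is unique; see
  \<open>noncentral_stirling_ex1\<close> below.\<close>

definition noncentral_stirling :: "nat \<Rightarrow> nat \<Rightarrow> real \<Rightarrow> real" where
  "noncentral_stirling n k \<phi> =
     (THE c. (\<forall>x::real. (x + \<phi>) ^ n = (\<Sum>j\<le>n. c j * falling_fact x j)) \<and> (\<forall>j>n. c j = 0)) k"

text \<open>The truncated subtraction below is harmless because only \<open>k \<ge> 1\<close> is of interest.\<close>

definition neg_bin :: "nat \<Rightarrow> nat \<Rightarrow> real \<Rightarrow> real" where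
  "neg_bin t k p = real ((k + t - 1) choose t) * p ^ t * (1 - p) ^ k"

definition neg_occ_fin :: "nat \<Rightarrow> nat \<Rightarrow> nat \<Rightarrow> real \<Rightarrow> real" where
  "neg_occ_fin t m k \<theta> =
     \<theta> ^ (k + t) / real m ^ (k + t) * falling_fact (real m) k *
       noncentral_stirling (k + t - 1) (k - 1) (real m * ((1 - \<theta>) / \<theta>))"

text \<open>For \<open>m = \<infinity>\<close> the limit exists and equals \<open>neg_bin t k (1 - \<theta>)\<close>; see
  \<open>neg_occ_fin_tendsto\<close> and \<open>neg_occ_infinity\<close> below.\<close>

definition neg_occ :: "nat \<Rightarrow> enat \<Rightarrow> nat \<Rightarrow> real \<Rightarrow> real" where
  "neg_occ t m k \<theta> =
     (case m of enat n \<Rightarrow> neg_occ_fin t n k \<theta>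
      | \<infinity> \<Rightarrow> lim (\<lambda>n. neg_occ_fin t n k \<theta>))"

abbreviation neg_occ_classical :: "nat \<Rightarrow> enat \<Rightarrow> nat \<Rightarrow> real" where
  "neg_occ_classical t m k \<equiv> neg_occ t m k 1"

subsection \<open>Well-definedness\<close>

lemma falling_fact_0 [simp]: "falling_fact x 0 = 1"
  by (simp add: falling_fact_def)

lemma falling_fact_Suc: "falling_fact x (Suc k) = falling_fact x k * (x - real k)"
  by (simp add: falling_fact_def)

lemma falling_fact_eq_0: "j < k \<Longrightarrow> falling_fact (real j) k = 0"
  by (auto simp: falling_fact_def)

lemma falling_fact_self: "falling_fact (real j) j \<noteq> 0"
  by (auto simp: falling_fact_def)

fun ncs_rec :: "real \<Rightarrow> nat \<Rightarrow> nat \<Rightarrow> real" where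
  "ncs_rec \<phi> 0 k = (if k = 0 then 1 else 0)"
| "ncs_rec \<phi> (Suc n) k =
     (real k + \<phi>) * ncs_rec \<phi> n k + (case k of 0 \<Rightarrow> 0 | Suc l \<Rightarrow> ncs_rec \<phi> n l)"

lemma ncs_rec_eq_0: "n < k \<Longrightarrow> ncs_rec \<phi> n k = 0"
  by (induction n arbitrary: k) (auto split: nat.splits)

lemma ncs_rec_expansion: "(x + \<phi>) ^ n = (\<Sum>j\<le>n. ncs_rec \<phi> n j * falling_fact x j)"
proof (induction n)
  case (Suc n)
  let ?c = "ncs_rec \<phi> n" and ?f = "falling_fact x"
  have split: "(x + \<phi>) * ?f j = ?f (Suc j) + (real j + \<phi>) * ?f j" for j
    by (simp add: falling_fact_Suc algebra_simps)
  have "(x + \<phi>) ^ Suc n = (\<Sum>j\<le>n. ?c j * ((x + \<phi>) * ?f j))"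
    by (simp add: Suc sum_distrib_left mult_ac)
  also have "\<dots> = (\<Sum>j\<le>n. ?c j * ?f (Suc j)) + (\<Sum>j\<le>n. (real j + \<phi>) * ?c j * ?f j)"
    unfolding split by (simp add: sum.distrib [symmetric] algebra_simps)
  also have "(\<Sum>j\<le>n. (real j + \<phi>) * ?c j * ?f j) = (\<Sum>j\<le>Suc n. (real j + \<phi>) * ?c j * ?f j)"
    by (simp add: ncs_rec_eq_0)
  also have "(\<Sum>j\<le>n. ?c j * ?f (Suc j)) =
      (\<Sum>j\<le>Suc n. (case j of 0 \<Rightarrow> 0 | Suc l \<Rightarrow> ?c l) * ?f j)"
    by (subst sum.atMost_Suc_shift) simp
  finally show ?case
    by (simp only: sum.distrib [symmetric] ncs_rec.simps distrib_right add.commute)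
qed simp

lemma falling_fact_coeffs_unique:
  assumes "\<And>x. (\<Sum>j\<le>n. c j * falling_fact x j) = (\<Sum>j\<le>n. d j * falling_fact x j)"
    and "j \<le> n"
  shows "c j = d j"
  using assms(2)
proof (induction j rule: less_induct)
  case (less j)
  have tail: "(\<Sum>i\<le>n. e i * falling_fact (real j) i) =
      (\<Sum>i<j. e i * falling_fact (real j) i) + e j * falling_fact (real j) j" for e :: "nat \<Rightarrow> real"
  proof -
    have "(\<Sum>i\<le>n. e i * falling_fact (real j) i) = (\<Sum>i\<le>j. e i * falling_fact (real j) i)"
      using less.prems by (intro sum.mono_neutral_right) (auto simp: falling_fact_eq_0)
    then show ?thesis
      by (simp add: lessThan_Suc_atMost [symmetric])
  qed
  have "(\<Sum>i<j. c i * falling_fact (real j) i) = (\<Sum>i<j. d i * falling_fact (real j) i)"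
    using less by (intro sum.cong) auto
  then show ?case
    using assms(1)[of "real j"] falling_fact_self[of j] by (simp add: tail)
qed

lemma noncentral_stirling_ex1:
  "\<exists>!c. (\<forall>x::real. (x + \<phi>) ^ n = (\<Sum>j\<le>n. c j * falling_fact x j)) \<and> (\<forall>j>n. c j = 0)"
proof (rule ex1I [where a = "ncs_rec \<phi> n"])
  fix c
  assume c: "(\<forall>x::real. (x + \<phi>) ^ n = (\<Sum>j\<le>n. c j * falling_fact x j)) \<and> (\<forall>j>n. c j = 0)"
  have "c j = ncs_rec \<phi> n j" for j
  proof (cases "j \<le> n")
    case True
    have "(\<Sum>i\<le>n. c i * falling_fact x i) = (\<Sum>i\<le>n. ncs_rec \<phi> n i * falling_fact x i)" for x
      using c ncs_rec_expansion[of x \<phi> n] by metis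
    then show ?thesis
      using True by (rule falling_fact_coeffs_unique)
  qed (use c in \<open>simp add: ncs_rec_eq_0\<close>)
  then show "c = ncs_rec \<phi> n" by blast
qed (use ncs_rec_expansion ncs_rec_eq_0 in blast)

lemma noncentral_stirling_eq_ncs_rec: "noncentral_stirling n k \<phi> = ncs_rec \<phi> n k"
proof -
  have "(THE c. (\<forall>x::real. (x + \<phi>) ^ n = (\<Sum>j\<le>n. c j * falling_fact x j)) \<and> (\<forall>j>n. c j = 0)) =
      ncs_rec \<phi> n"
    by (rule the1_equality [OF noncentral_stirling_ex1])
      (use ncs_rec_expansion ncs_rec_eq_0 in blast)
  then show ?thesis
    by (simp add: noncentral_stirling_def)
qed

lemma ncs_rec_self: "ncs_rec \<phi> k k = 1"
  by (induction k) (auto simp: ncs_rec_eq_0)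

lemma ncs_rec_scaled_tendsto:
  "(\<lambda>m. ncs_rec (real m * a) (l + t) l / real m ^ t) \<longlonglongrightarrow> real ((l + t) choose t) * a ^ t"
proof (induction t arbitrary: l)
  case 0
  show ?case by (simp add: ncs_rec_self)
next
  case (Suc t)
  have aux: "(\<lambda>m. (real l + real m * a) * x m / real m ^ Suc t) \<longlonglongrightarrow> a * L"
    if "(\<lambda>m. x m / real m ^ t) \<longlonglongrightarrow> L" for l x L
  proof -
    have "(\<lambda>m. (real l * inverse (real m) + a) * (x m / real m ^ t)) \<longlonglongrightarrow> (real l * 0 + a) * L"
      by (intro tendsto_intros that LIMSEQ_inverse_real_of_nat lim_inverse_n)
    moreover have "\<forall>\<^sub>F m in sequentially. (real l * inverse (real m) + a) * (x m / real m ^ t) =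
        (real l + real m * a) * x m / real m ^ Suc t"
      using eventually_gt_at_top[of 0] by eventually_elim (simp add: field_simps)
    ultimately show ?thesis
      by (simp add: filterlim_cong)
  qed
  show ?case
  proof (induction l)
    case 0
    show ?case
      using aux[OF Suc[of 0], of 0] by simp
  next
    case (Suc l)
    have "(\<lambda>m. (real (Suc l) + real m * a) * ncs_rec (real m * a) (Suc l + t) (Suc l) / real m ^ Suc t
         + ncs_rec (real m * a) (l + Suc t) l / real m ^ Suc t)
       \<longlonglongrightarrow> a * (real ((Suc l + t) choose t) * a ^ t) + real ((l + Suc t) choose Suc t) * a ^ Suc t"
      by (intro tendsto_add aux[OF \<open>\<And>l. (\<lambda>m. ncs_rec (real m * a) (l + t) l / real m ^ t)
        \<longlonglongrightarrow> real ((l + t) choose t) * a ^ t\<close>] Suc)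
    moreover have "ncs_rec x (Suc l + Suc t) (Suc l) =
        (real (Suc l) + x) * ncs_rec x (Suc l + t) (Suc l) + ncs_rec x (l + Suc t) l" for x
      by simp
    moreover have "a * (real ((Suc l + t) choose t) * a ^ t) + real ((l + Suc t) choose Suc t) * a ^ Suc t
        = real ((Suc l + Suc t) choose Suc t) * a ^ Suc t"
      by (simp add: algebra_simps)
    ultimately show ?case
      by (simp only: add_divide_distrib)
  qed
qed

lemma falling_fact_scaled_tendsto: "(\<lambda>m. falling_fact (real m) k / real m ^ k) \<longlonglongrightarrow> 1"
proof (induction k)
  case (Suc k)
  have "(\<lambda>m. falling_fact (real m) k / real m ^ k * (1 - real k * inverse (real m)))
      \<longlonglongrightarrow> 1 * (1 - real k * 0)"
    by (intro tendsto_intros Suc lim_inverse_n)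
  moreover have "\<forall>\<^sub>F m in sequentially.
      falling_fact (real m) k / real m ^ k * (1 - real k * inverse (real m)) =
      falling_fact (real m) (Suc k) / real m ^ Suc k"
    using eventually_gt_at_top[of 0]
    by eventually_elim (simp add: falling_fact_Suc field_simps)
  ultimately show ?case
    by (simp add: filterlim_cong)
qed simp

lemma neg_occ_fin_tendsto:
  assumes "k \<ge> 1" "0 < \<theta>"
  shows "(\<lambda>m. neg_occ_fin t m k \<theta>) \<longlonglongrightarrow> neg_bin t k (1 - \<theta>)"
proof -
  obtain l where k: "k = Suc l"
    using assms(1) by (cases k) auto
  define a where "a = (1 - \<theta>) / \<theta>"
  have "(\<lambda>m. \<theta> ^ (k + t) * (falling_fact (real m) k / real m ^ k) *
      (ncs_rec (real m * a) (l + t) l / real m ^ t))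
      \<longlonglongrightarrow> \<theta> ^ (k + t) * 1 * (real ((l + t) choose t) * a ^ t)"
    by (intro tendsto_intros falling_fact_scaled_tendsto ncs_rec_scaled_tendsto)
  moreover have "\<theta> ^ (k + t) * 1 * (real ((l + t) choose t) * a ^ t) = neg_bin t k (1 - \<theta>)"
    using assms(2) by (simp add: neg_bin_def k a_def power_add power_divide)
  moreover have "neg_occ_fin t m k \<theta> = \<theta> ^ (k + t) * (falling_fact (real m) k / real m ^ k) *
      (ncs_rec (real m * a) (l + t) l / real m ^ t)" for m
    by (simp add: neg_occ_fin_def noncentral_stirling_eq_ncs_rec k a_def power_add)
  ultimately show ?thesis
    by simp
qed

lemma neg_occ_infinity:
  assumes "k \<ge> 1" "0 < \<theta>"
  shows "neg_occ t \<infinity> k \<theta> = neg_bin t k (1 - \<theta>)"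
  using limI [OF neg_occ_fin_tendsto [OF assms]] by (simp add: neg_occ_def)

end

theory Submission
  imports Defs
begin

text \<open>Expanding \<open>(x + \<phi> + \<psi>) ^ n\<close> binomially in powers of \<open>x + \<phi>\<close> gives a convolution formula for
  noncentral Stirling numbers under a shift of the noncentrality parameter. For finite \<open>m\<close> the theorem
  is this formula with \<open>\<phi> = m (1 - \<gamma>) / \<gamma>\<close> and \<open>\<psi> = m (1 - \<theta>) / (\<gamma> \<theta>)\<close>, whose sum is
  \<open>m (1 - \<gamma> \<theta>) / (\<gamma> \<theta>)\<close>; the case \<open>m = \<infinity>\<close> follows by letting \<open>m\<close> tend to infinity.\<close>

lemma ncs_rec_add:
  "ncs_rec (\<phi> + \<psi>) n l = (\<Sum>j\<le>n. real (n choose j) * \<psi> ^ (n - j) * ncs_rec \<phi> j l)"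
proof (cases "l \<le> n")
  case True
  \<comment> \<open>Both sides expand the same polynomial in the falling factorial basis, so
    uniqueness of coefficients gives the claim.\<close>
  have "(\<Sum>i\<le>n. ncs_rec (\<phi> + \<psi>) n i * falling_fact x i) =
      (\<Sum>i\<le>n. (\<Sum>j\<le>n. real (n choose j) * \<psi> ^ (n - j) * ncs_rec \<phi> j i) * falling_fact x i)" for x
  proof -
    have "(\<Sum>i\<le>n. ncs_rec (\<phi> + \<psi>) n i * falling_fact x i) = ((x + \<phi>) + \<psi>) ^ n"
      by (simp add: ncs_rec_expansion [symmetric] add.assoc)
    also have "\<dots> = (\<Sum>j\<le>n. real (n choose j) * \<psi> ^ (n - j) * (x + \<phi>) ^ j)"
      unfolding binomial_ring by (simp add: mult_ac)
    also have "\<dots> = (\<Sum>j\<le>n. real (n choose j) * \<psi> ^ (n - j) *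
        (\<Sum>i\<le>n. ncs_rec \<phi> j i * falling_fact x i))"
    proof (rule sum.cong [OF refl])
      fix j assume "j \<in> {..n}"
      \<comment> \<open>Padding with vanishing coefficients makes the inner range independent of
        \<open>j\<close>, so that the two sums can be swapped.\<close>
      then have "(\<Sum>i\<le>j. ncs_rec \<phi> j i * falling_fact x i) =
          (\<Sum>i\<le>n. ncs_rec \<phi> j i * falling_fact x i)"
        by (intro sum.mono_neutral_left) (auto simp: ncs_rec_eq_0)
      then show "real (n choose j) * \<psi> ^ (n - j) * (x + \<phi>) ^ j =
          real (n choose j) * \<psi> ^ (n - j) * (\<Sum>i\<le>n. ncs_rec \<phi> j i * falling_fact x i)"
        by (simp add: ncs_rec_expansion)
    qed
    also have "\<dots> = (\<Sum>i\<le>n. (\<Sum>j\<le>n. real (n choose j) * \<psi> ^ (n - j) * ncs_rec \<phi> j i) *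
        falling_fact x i)"
      unfolding sum_distrib_left sum_distrib_right by (subst sum.swap) (simp add: mult_ac)
    finally show ?thesis .
  qed
  then show ?thesis
    using True by (rule falling_fact_coeffs_unique)
qed (simp add: ncs_rec_eq_0)

text \<open>In the convolution the terms with \<open>j < l\<close> vanish; put
  \<open>j = l + r\<close>. By symmetry the binomial coefficient takes the form it has in
  \<open>neg_bin (t - r) (k + r)\<close> for \<open>k = Suc l\<close>.\<close>

lemma ncs_rec_add_diagonal:
  "ncs_rec (\<phi> + \<psi>) (l + t) l =
     (\<Sum>r\<le>t. real ((l + t) choose (t - r)) * \<psi> ^ (t - r) * ncs_rec \<phi> (l + r) l)"
proof -
  let ?g = "\<lambda>j. real ((l + t) choose j) * \<psi> ^ (l + t - j) * ncs_rec \<phi> j l"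
  have "ncs_rec (\<phi> + \<psi>) (l + t) l = sum ?g {..l + t}"
    by (rule ncs_rec_add)
  also have "\<dots> = sum ?g {0 + l..t + l}"
    by (rule sum.mono_neutral_right) (auto simp: ncs_rec_eq_0)
  also have "\<dots> = (\<Sum>r\<le>t. ?g (r + l))"
    by (simp only: sum.shift_bounds_cl_nat_ivl atMost_atLeast0)
  also have "\<dots> = (\<Sum>r\<le>t. real ((l + t) choose (t - r)) * \<psi> ^ (t - r) * ncs_rec \<phi> (l + r) l)"
  proof (rule sum.cong [OF refl])
    fix r assume "r \<in> {..t}"
    then have "(l + t) choose (r + l) = (l + t) choose (t - r)"
      by (subst binomial_symmetric) auto
    then show "?g (r + l) = real ((l + t) choose (t - r)) * \<psi> ^ (t - r) * ncs_rec \<phi> (l + r) l"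
      by (simp add: add.commute)
  qed
  finally show ?thesis .
qed

text \<open>The identity holds term by term once the Stirling number on the left is expanded by
  \<open>ncs_rec_add_diagonal\<close>.\<close>

lemma neg_occ_fin_mult:
  assumes "k \<ge> 1" "m > 0" "\<theta> > 0" "\<gamma> > 0"
  shows "neg_occ_fin t m k (\<gamma> * \<theta>) =
    (\<Sum>r=0..t. neg_bin (t - r) (k + r) (1 - \<theta>) * neg_occ_fin r m k \<gamma>)"
proof -
  obtain l where k: "k = Suc l"
    using assms(1) by (cases k) auto
  define \<phi> where "\<phi> = real m * ((1 - \<gamma>) / \<gamma>)"
  define \<psi> where "\<psi> = real m * (1 - \<theta>) / (\<gamma> * \<theta>)"
  have shift: "real m * ((1 - \<gamma> * \<theta>) / (\<gamma> * \<theta>)) = \<phi> + \<psi>"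
    using assms by (simp add: \<phi>_def \<psi>_def field_simps)
  have "(\<gamma> * \<theta>) ^ (k + t) / real m ^ (k + t) * falling_fact (real m) k *
        (real ((l + t) choose (t - r)) * \<psi> ^ (t - r) * ncs_rec \<phi> (l + r) l) =
      neg_bin (t - r) (k + r) (1 - \<theta>) * neg_occ_fin r m k \<gamma>" if le: "r \<le> t" for r
  proof -
    obtain s where s: "t = r + s"
      using le_Suc_ex [OF le] ..
    \<comment> \<open>The upper index is \<open>(k + r) + (t - r) - 1 = l + t\<close>, because
      \<open>k = Suc l\<close>.\<close>
    have bin: "neg_bin (t - r) (k + r) (1 - \<theta>) =
        real ((l + t) choose s) * (1 - \<theta>) ^ s * \<theta> ^ (k + r)"
      by (simp add: neg_bin_def k s add.assoc)
    have occ: "neg_occ_fin r m k \<gamma> =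
        \<gamma> ^ (k + r) / real m ^ (k + r) * falling_fact (real m) k * ncs_rec \<phi> (l + r) l"
      by (simp add: neg_occ_fin_def noncentral_stirling_eq_ncs_rec \<phi>_def k)
    have "(\<gamma> * \<theta>) ^ (k + t) = \<gamma> ^ (k + r) * \<theta> ^ (k + r) * (\<gamma> * \<theta>) ^ s"
      by (simp only: s power_add power_mult_distrib mult_ac)
    moreover have "real m ^ (k + t) = real m ^ (k + r) * real m ^ s"
      by (simp only: s power_add mult_ac)
    moreover have "\<psi> ^ s = real m ^ s * (1 - \<theta>) ^ s / (\<gamma> * \<theta>) ^ s"
      by (simp only: \<psi>_def power_divide power_mult_distrib)
    moreover have "(\<gamma> * \<theta>) ^ s \<noteq> 0" "real m ^ s \<noteq> 0"
      using assms by auto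
    \<comment> \<open>The factors \<open>(\<gamma> * \<theta>) ^ s\<close> and
      \<open>real m ^ s\<close> cancel against those in \<open>\<psi> ^ s\<close>; they are kept as
      unexpanded powers so that the nonvanishing facts apply.\<close>
    ultimately have weight: "(\<gamma> * \<theta>) ^ (k + t) / real m ^ (k + t) * \<psi> ^ s =
        (1 - \<theta>) ^ s * \<theta> ^ (k + r) * (\<gamma> ^ (k + r) / real m ^ (k + r))"
      by (simp del: power_eq_0_iff power_mult_distrib)
    have "t - r = s"
      by (simp add: s)
    then have "(\<gamma> * \<theta>) ^ (k + t) / real m ^ (k + t) * falling_fact (real m) k *
        (real ((l + t) choose (t - r)) * \<psi> ^ (t - r) * ncs_rec \<phi> (l + r) l) =
        ((\<gamma> * \<theta>) ^ (k + t) / real m ^ (k + t) * \<psi> ^ s) *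
        (real ((l + t) choose s) * falling_fact (real m) k * ncs_rec \<phi> (l + r) l)"
      by (simp only: mult_ac)
    also have "\<dots> = neg_bin (t - r) (k + r) (1 - \<theta>) * neg_occ_fin r m k \<gamma>"
      unfolding weight bin occ by (simp only: mult_ac)
    finally show ?thesis .
  qed
  moreover have "neg_occ_fin t m k (\<gamma> * \<theta>) =
      (\<gamma> * \<theta>) ^ (k + t) / real m ^ (k + t) * falling_fact (real m) k * ncs_rec (\<phi> + \<psi>) (l + t) l"
    by (simp only: neg_occ_fin_def noncentral_stirling_eq_ncs_rec shift) (simp add: k)
  ultimately show ?thesis
    by (simp only: ncs_rec_add_diagonal sum_distrib_left atMost_atLeast0) simp
qed

lemma neg_occ_mult:
  assumes "k \<ge> 1" "enat k \<le> m" "\<theta> > 0" "\<gamma> > 0"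
  shows "neg_occ t m k (\<gamma> * \<theta>) =
    (\<Sum>r=0..t. neg_bin (t - r) (k + r) (1 - \<theta>) * neg_occ r m k \<gamma>)"
proof (cases m)
  case (enat n)
  with assms show ?thesis
    \<comment> \<open>Here \<open>n > 0\<close> follows from
      \<open>1 \<le> k \<le> n\<close>.\<close>
    by (simp add: neg_occ_def neg_occ_fin_mult)
next
  case infinity
  have "(\<lambda>n. \<Sum>r=0..t. neg_bin (t - r) (k + r) (1 - \<theta>) * neg_occ_fin r n k \<gamma>)
      \<longlonglongrightarrow> (\<Sum>r=0..t. neg_bin (t - r) (k + r) (1 - \<theta>) * neg_occ r \<infinity> k \<gamma>)"
    \<comment> \<open>With the limit values in closed form, the finite sum converges term by term,
      as its \<open>neg_bin\<close> weights do not depend on \<open>n\<close>.\<close>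
    unfolding neg_occ_infinity [OF assms(1,4)]
    by (intro tendsto_intros neg_occ_fin_tendsto assms)
  \<comment> \<open>The finite identity requires \<open>n > 0\<close>, hence equality is claimed
    only eventually.\<close>
  moreover have "\<forall>\<^sub>F n in sequentially.
      (\<Sum>r=0..t. neg_bin (t - r) (k + r) (1 - \<theta>) * neg_occ_fin r n k \<gamma>) =
      neg_occ_fin t n k (\<gamma> * \<theta>)"
    using eventually_gt_at_top [of 0] by eventually_elim (simp add: neg_occ_fin_mult [OF assms(1) _ assms(3,4)])
  ultimately have "(\<lambda>n. neg_occ_fin t n k (\<gamma> * \<theta>))
      \<longlonglongrightarrow> (\<Sum>r=0..t. neg_bin (t - r) (k + r) (1 - \<theta>) * neg_occ r \<infinity> k \<gamma>)"
    by (rule Lim_transform_eventually)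
  then show ?thesis
    by (simp add: infinity neg_occ_def limI)
qed

theorem theorem14:
  fixes k t :: nat and m :: enat and \<theta> \<gamma> :: real
  assumes "k \<ge> 1" and "enat k \<le> m"
    and "0 < \<theta>" "\<theta> \<le> 1" and "0 < \<gamma>" "\<gamma> \<le> 1"
  shows "neg_occ t m k (\<gamma> * \<theta>) =
           (\<Sum>r=0..t. neg_bin (t - r) (k + r) (1 - \<theta>) * neg_occ r m k \<gamma>) \<and>
         neg_occ t m k \<theta> =
           (\<Sum>r=0..t. neg_bin (t - r) (k + r) (1 - \<theta>) * neg_occ_classical r m k)"
  using neg_occ_mult [of k m \<theta> \<gamma> t] neg_occ_mult [of k m \<theta> 1 t] assms by simp

end
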